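(* Let $(U,b_U)$ and $(W,b_W)$ be two bilinear spaces over $\mathbb{F}_2$, and let $\sigma\in\mathrm{Iso}(U)$ and $\theta\in\mathrm{Iso}(W)$ be two involutions. Consider the involution $\sigma\oplus\theta$ of the orthogonal direct sum $U\oplus W$. \begin{itemize} \item[(a)] $DD(\sigma\oplus\theta)=DD(\sigma)\# DD(\theta)$ if either $U$ or $W$ is SYMP. \item[(b)] If $U$ and $W$ are both ODDO then $$DD(\sigma\oplus\theta)=[D(\sigma)+D(\theta),\,1,\,D(\sigma)+D(\theta)+1,\,\max\{\alpha(\sigma),\alpha(\theta)\}]=\bigl[DD(\sigma)\# DD(\theta)\bigr]\#[0,1,1,0].$$ \item[(c)] If $U$ is ODDO and $W$ is EVO then $$DD(\sigma\oplus\theta)=[D(\sigma)+D(\theta),\,\max\{\alpha(\sigma),\tilde\alpha(\theta)\},\,D(\sigma)+D(\theta),\,\max\{\alpha(\sigma),\tilde\alpha(\theta)\}].$$ \item[(d)] If $U$ and $W$ are both EVO then $DD(\sigma\oplus\theta)=[DD(\sigma)\# DD(\theta)]+E$, where $+$ is componentwise addition and $$E=\begin{cases} [0,0,0,0] & \text{if } \tilde D(\sigma)=D(\sigma) \text{ or } \tilde D(\theta)=D(\theta),\\ [0,0,-1,0] & \text{if } \tilde D(\sigma)>D(\sigma) \text{ and } \tilde D(\theta)>D(\theta),\\ [0,0,1,0] & \text{if } \tilde D(\sigma)>D(\sigma) \text{ and } \tilde D(\theta)<D(\theta),\\ [0,0,1,0] & \text{if } \tilde D(\sigma)<D(\sigma)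 \text{ and } \tilde D(\theta)>D(\theta),\\ [0,0,2,0] & \text{if } \tilde D(\sigma)<D(\sigma) \text{ and } \tilde D(\theta)<D(\theta). \end{cases}$$ \end{itemize}
   Context: A bilinear space over $\mathbb{F}_2$ is a finite-dimensional $\mathbb{F}_2$-vector space $V$ with a nondegenerate symmetric bilinear form $b$. $\mathrm{Iso}(V)$ is its group of isometries (linear automorphisms preserving $b$); an involution is an element $\sigma$ with $\sigma^2=\mathrm{Id}$ (identity included). $V$ is SYMP (symplectic) if $b(v,v)=0$ for all $v$; otherwise $V$ is isomorphic to $\mathbb{F}_2^n$ with the standard dot product for some $n\ge 1$ and is called EVO if $n$ is even, ODDO if $n$ is odd. The distinguished vector $\Omega\in V$ is the unique vector with $b(\Omega,v)=b(v,v)$ for all $v$; every isometry fixes $\Omega$. For an involution $\sigma\in\mathrm{Iso}(V)$, $D(\sigma)=\mathrm{rank}(\sigma+\mathrm{Id})$ in all cases. The invariants $\alpha(\sigma)\in\{0,1\}$, $\tilde D(\sigma)$, $\tilde\alpha(\sigma)$ are defined as follows. \begin{itemize} \item $V$ SYMP: $\alpha(\sigma)=1$ if there is $v\in V$ with $b(v,\sigma v)=1$, and $0$ otherwise; $\tilde D(\sigma)=D(\sigma)$ and $\tilde\alpha(\sigma)=\alpha(\sigma)$. \item $V$ EVO: $\alpha(\sigma)=1$ if there is $v\in V$ with $b(v,\sigma v)=1$, and $0$ otherwise; $\tilde D(\sigma)=D(m\sigma)$ and $\tilde\alpha(\sigma)=\alpha(m\sigma)$, where $m\sigma$ is the involution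 in $\mathrm{Iso}(V)$ given by $(m\sigma)(v)=\sigma(v)+b(v,\Omega)\Omega$. \item $V$ ODDO: $\sigma$ restricts to $\sigma'$ on the symplectic space $\langle\Omega\rangle^\perp$, and $\alpha(\sigma)=\alpha(\sigma')$, i.e. $\alpha(\sigma)=1$ if there is $v\in\langle\Omega\rangle^\perp$ with $b(v,\sigma v)=1$, and $0$ otherwise; $\tilde D(\sigma)=D(\sigma)$ and $\tilde\alpha(\sigma)=\alpha(\sigma)$. \end{itemize} In all cases $DD(\sigma)=[D(\sigma),\alpha(\sigma),\tilde D(\sigma),\tilde\alpha(\sigma)]$. For such tuples $X,Y$, $X\# Y=[X_1+Y_1,\max\{X_2,Y_2\},X_3+Y_3,\max\{X_4,Y_4\}]$ (second and fourth entries are regarded as elements of $\{0,1\}$). *)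

theory Defs
  imports "HOL-Analysis.Product_Vector" "HOL-Library.Z2" "HOL-Library.FuncSet"
begin

text \<open>
  An \<open>\<bbbF>\<^sub>2\<close>-vector space is a type of class \<^class>\<open>ab_group_add\<close> with a scalar multiplication
  \<open>s\<close> by the field \<^typ>\<open>bit\<close>; the whole type is the underlying set of vectors.
\<close>

definition bilinear_form ::
  "(bit \<Rightarrow> 'v \<Rightarrow> 'v) \<Rightarrow> ('v::ab_group_add \<Rightarrow> 'v \<Rightarrow> bit) \<Rightarrow> bool" where
  "bilinear_form s b \<longleftrightarrow>
     (\<forall>u. Vector_Spaces.linear s (*) (\<lambda>v. b u v)) \<and>
     (\<forall>v. Vector_Spaces.linear s (*) (\<lambda>u. b u v))"

definition bilinear_space ::
  "(bit \<Rightarrow> 'v \<Rightarrow> 'v) \<Rightarrow> ('v::ab_group_add \<Rightarrow> 'v \<Rightarrow> bit) \<Rightarrow> bool" where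
  "bilinear_space s b \<longleftrightarrow>
     (\<exists>B. finite_dimensional_vector_space s B) \<and>
     bilinear_form s b \<and>
     (\<forall>u v. b u v = b v u) \<and>
     (\<forall>u. (\<forall>v. b u v = 0) \<longrightarrow> u = 0)"

definition isometry ::
  "(bit \<Rightarrow> 'v \<Rightarrow> 'v) \<Rightarrow> ('v::ab_group_add \<Rightarrow> 'v \<Rightarrow> bit) \<Rightarrow> ('v \<Rightarrow> 'v) \<Rightarrow> bool" where
  "isometry s b f \<longleftrightarrow>
     Vector_Spaces.linear s s f \<and> bij f \<and> (\<forall>u v. b (f u) (f v) = b u v)"

definition involution ::
  "(bit \<Rightarrow> 'v \<Rightarrow> 'v) \<Rightarrow> ('v::ab_group_add \<Rightarrow> 'v \<Rightarrow> bit) \<Rightarrow> ('v \<Rightarrow> 'v) \<Rightarrow> bool" where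
  "involution s b f \<longleftrightarrow> isometry s b f \<and> f \<circ> f = id"

definition SYMP :: "('v::ab_group_add \<Rightarrow> 'v \<Rightarrow> bit) \<Rightarrow> bool" where
  "SYMP b \<longleftrightarrow> (\<forall>v. b v v = 0)"

text \<open>
  \<open>\<bbbF>\<^sub>2\<^sup>n\<close> is the set of functions \<open>{..<n} \<rightarrow>\<^sub>E UNIV\<close>; its operations are pointwise, so a map
  into it is linear iff each of its coordinates is.
\<close>

definition iso_standard ::
  "(bit \<Rightarrow> 'v \<Rightarrow> 'v) \<Rightarrow> ('v::ab_group_add \<Rightarrow> 'v \<Rightarrow> bit) \<Rightarrow> nat \<Rightarrow> bool" where
  "iso_standard s b n \<longleftrightarrow>
     (\<exists>f. bij_betw f UNIV ({..<n} \<rightarrow>\<^sub>E (UNIV :: bit set)) \<and>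
          (\<forall>i<n. Vector_Spaces.linear s (*) (\<lambda>v. f v i)) \<and>
          (\<forall>u v. b u v = (\<Sum>i<n. f u i * f v i)))"

definition EVO ::
  "(bit \<Rightarrow> 'v \<Rightarrow> 'v) \<Rightarrow> ('v::ab_group_add \<Rightarrow> 'v \<Rightarrow> bit) \<Rightarrow> bool" where
  "EVO s b \<longleftrightarrow> \<not> SYMP b \<and> (\<exists>n\<ge>1. even n \<and> iso_standard s b n)"

definition ODDO ::
  "(bit \<Rightarrow> 'v \<Rightarrow> 'v) \<Rightarrow> ('v::ab_group_add \<Rightarrow> 'v \<Rightarrow> bit) \<Rightarrow> bool" where
  "ODDO s b \<longleftrightarrow> \<not> SYMP b \<and> (\<exists>n\<ge>1. odd n \<and> iso_standard s b n)"

definition Omega :: "('v::ab_group_add \<Rightarrow> 'v \<Rightarrow> bit) \<Rightarrow> 'v" where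
  "Omega b = (THE w. \<forall>v. b w v = b v v)"

definition twist ::
  "(bit \<Rightarrow> 'v \<Rightarrow> 'v) \<Rightarrow> ('v::ab_group_add \<Rightarrow> 'v \<Rightarrow> bit) \<Rightarrow> ('v \<Rightarrow> 'v) \<Rightarrow> 'v \<Rightarrow> 'v" where
  "twist s b f v = f v + s (b v (Omega b)) (Omega b)"

text \<open>All four invariants are integers, since they are combined with negative corrections.\<close>

definition D_inv :: "(bit \<Rightarrow> 'v \<Rightarrow> 'v) \<Rightarrow> ('v::ab_group_add \<Rightarrow> 'v) \<Rightarrow> int" where
  "D_inv s f = int (vector_space.dim s (range (\<lambda>v. f v + v)))"

definition alpha ::
  "(bit \<Rightarrow> 'v \<Rightarrow> 'v) \<Rightarrow> ('v::ab_group_add \<Rightarrow> 'v \<Rightarrow> bit) \<Rightarrow> ('v \<Rightarrow> 'v) \<Rightarrow> int" where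
  "alpha s b f =
     (if ODDO s b then of_bool (\<exists>v. b (Omega b) v = 0 \<and> b v (f v) = 1)
      else of_bool (\<exists>v. b v (f v) = 1))"

definition D_tilde ::
  "(bit \<Rightarrow> 'v \<Rightarrow> 'v) \<Rightarrow> ('v::ab_group_add \<Rightarrow> 'v \<Rightarrow> bit) \<Rightarrow> ('v \<Rightarrow> 'v) \<Rightarrow> int" where
  "D_tilde s b f = (if EVO s b then D_inv s (twist s b f) else D_inv s f)"

definition alpha_tilde ::
  "(bit \<Rightarrow> 'v \<Rightarrow> 'v) \<Rightarrow> ('v::ab_group_add \<Rightarrow> 'v \<Rightarrow> bit) \<Rightarrow> ('v \<Rightarrow> 'v) \<Rightarrow> int" where
  "alpha_tilde s b f = (if EVO s b then alpha s b (twist s b f) else alpha s b f)"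

definition DD ::
  "(bit \<Rightarrow> 'v \<Rightarrow> 'v) \<Rightarrow> ('v::ab_group_add \<Rightarrow> 'v \<Rightarrow> bit) \<Rightarrow> ('v \<Rightarrow> 'v) \<Rightarrow> int \<times> int \<times> int \<times> int" where
  "DD s b f = (D_inv s f, alpha s b f, D_tilde s b f, alpha_tilde s b f)"

fun DD_join ::
  "int \<times> int \<times> int \<times> int \<Rightarrow> int \<times> int \<times> int \<times> int \<Rightarrow> int \<times> int \<times> int \<times> int"
  (infixl \<open>\<sharp>\<close> 65) where
  "(x1, x2, x3, x4) \<sharp> (y1, y2, y3, y4) = (x1 + y1, max x2 y2, x3 + y3, max x4 y4)"

text \<open>
  The orthogonal direct sum lives on the product type, with scalar multiplication
  \<^const>\<open>module_prod.scale\<close>; the direct sum of two maps is \<^const>\<open>map_prod\<close>.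
\<close>

definition sum_form ::
  "('u \<Rightarrow> 'u \<Rightarrow> bit) \<Rightarrow> ('w \<Rightarrow> 'w \<Rightarrow> bit) \<Rightarrow> 'u \<times> 'w \<Rightarrow> 'u \<times> 'w \<Rightarrow> bit" where
  "sum_form b c x y = b (fst x) (fst y) + c (snd x) (snd y)"

lemma bilinear_space_sum:
  assumes "bilinear_space s b" "bilinear_space t c"
  shows "bilinear_space (module_prod.scale s t) (sum_form b c)"
proof -
  from assms obtain B C where
    "finite_dimensional_vector_space s B" "finite_dimensional_vector_space t C"
    by (auto simp: bilinear_space_def)
  then interpret finite_dimensional_vector_space_prod s t B C
    by (simp add: finite_dimensional_vector_space_prod_def finite_dimensional_vector_space_pair_def
        vector_space_prod_def vector_space_pair_def finite_dimensional_vector_space_def)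
  have lin: "Vector_Spaces.linear scale (*) (\<lambda>x. g (fst x) + h (snd x))"
    if "Vector_Spaces.linear s (*) g" "Vector_Spaces.linear t (*) h"
    for g :: "'a \<Rightarrow> bit" and h :: "'b \<Rightarrow> bit"
  proof -
    interpret g: Vector_Spaces.linear s "(*)" g by fact
    interpret h: Vector_Spaces.linear t "(*)" h by fact
    show ?thesis
      by unfold_locales
        (simp_all only: g.add h.add g.scale h.scale scale_def fst_add snd_add fst_conv snd_conv
          distrib_left ac_simps)
  qed
  have nd: "x = 0" if "\<forall>y. sum_form b c x y = 0" for x
  proof -
    have z: "b u 0 = 0" "c w 0 = 0" for u w
      using assms
      by (metis bilinear_space_def bilinear_form_def Vector_Spaces.linear.axioms(3) module_hom.zero)+
    have "b (fst x) u = 0" for u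
      using spec[OF that, of "(u, 0)"] by (simp add: sum_form_def z)
    moreover have "c (snd x) w = 0" for w
      using spec[OF that, of "(0, w)"] by (simp add: sum_form_def z)
    ultimately show "x = 0"
      using assms unfolding bilinear_space_def by (simp add: prod_eq_iff)
  qed
  show ?thesis
    using assms p.finite_dimensional_vector_space_axioms lin nd
    unfolding bilinear_space_def bilinear_form_def
    by (auto simp: sum_form_def[abs_def])
qed

lemma involution_sum:
  assumes "involution s b f" "involution t c g"
  shows "involution (module_prod.scale s t) (sum_form b c) (map_prod f g)"
proof -
  interpret f: Vector_Spaces.linear s s f
    using assms by (simp add: involution_def isometry_def)
  interpret g: Vector_Spaces.linear t t g
    using assms by (simp add: involution_def isometry_def)
  interpret vector_space_prod s t by unfold_locales
  have "Vector_Spaces.linear scale scale (map_prod f g)"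
    by unfold_locales (auto simp: f.add g.add f.scale g.scale scale_def)
  then show ?thesis
    using assms
    by (auto simp: involution_def isometry_def sum_form_def map_prod_compose[symmetric]
        map_prod.id bij_def inj_def surj_def)
qed

end

theory Submission
  imports Defs
begin

text \<open>
  A non-symplectic space has an orthonormal basis, so its type is read off from \<open>b(\<Omega>,\<Omega>)\<close>,
  which is the dimension mod 2.  In every type, \<open>\<alpha>~(\<sigma>)\<close> tells whether the linear functional
  \<open>v \<mapsto> b(v, \<sigma> v) + b(\<Omega>, v)\<close> is non-zero; this functional is additive over orthogonal sums, so
  \<open>\<alpha>~\<close> always combines by maximum.  For the rank of \<open>m\<sigma> + Id\<close>, note that it is a rank one
  perturbation of \<open>A = \<sigma> + Id\<close> by \<open>\<Omega> \<otimes> \<Omega>\<close>, and exactly one of three cases holds: some \<open>y\<close> in the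
  kernel of \<open>A\<close> has \<open>b(\<Omega>, y) = 1\<close> (the rank grows by one), or \<open>\<Omega> = A y\<close> with \<open>b(\<Omega>, y) = 0\<close> (it
  is unchanged) or with \<open>b(\<Omega>, y) = 1\<close> (it drops by one).  Witnesses for \<open>\<sigma>\<close> and \<open>\<theta>\<close> combine to a
  witness for \<open>\<sigma> \<oplus> \<theta>\<close>.
\<close>

lemma bit_add_self [simp]: "(a::bit) + a = 0" "a + (a + c) = c"
  by (cases a; cases c; simp)+

lemma bit_add_eq_1_iff: "(a::bit) + c = 1 \<longleftrightarrow> (a = 1) \<noteq> (c = 1)"
  by (cases a; cases c; simp)

lemma bit_eq_iff_add: "(a::bit) = c \<longleftrightarrow> a + c = 0"
  by (cases a; cases c; simp)

lemma max_of_bool: "max (of_bool P) (of_bool Q) = (of_bool (P \<or> Q) :: int)"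
  by simp

section \<open>Bilinear spaces over the field with two elements\<close>

locale F2_bilinear_space =
  fixes s :: "bit \<Rightarrow> 'v::ab_group_add \<Rightarrow> 'v" and b :: "'v \<Rightarrow> 'v \<Rightarrow> bit"
  assumes bilinear_space: "bilinear_space s b"
begin

lemma finite_dimensional: obtains B where "finite_dimensional_vector_space s B"
  using bilinear_space by (auto simp: bilinear_space_def)

sublocale vector_space s
  using finite_dimensional by (auto simp: finite_dimensional_vector_space_def)

lemma add_self [simp]: "v + v = 0" "v + (v + w) = w" for v w :: 'v
proof -
  have "s (1 + 1) v = v + v"
    by (simp only: scale_left_distrib scale_one)
  then show "v + v = 0" by simp
  then show "v + (v + w) = w" by (simp flip: add.assoc)
qed

lemma eq_iff_add_eq_0: "v = w \<longleftrightarrow> v + w = 0" for v w :: 'v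
  by (metis add.right_neutral add_self)

lemma form_linear: "Vector_Spaces.linear s (*) (\<lambda>v. b u v)" "Vector_Spaces.linear s (*) (\<lambda>u. b u v)"
  using bilinear_space by (auto simp: bilinear_space_def bilinear_form_def)

lemma form_add [simp]: "b u (v + w) = b u v + b u w" "b (u + v) w = b u w + b v w"
  by (fact form_linear[THEN Vector_Spaces.linear.axioms(3), THEN module_hom.add])+

lemma form_scale [simp]: "b u (s c v) = c * b u v" "b (s c u) v = c * b u v"
  by (fact form_linear[THEN Vector_Spaces.linear.axioms(3), THEN module_hom.scale])+

lemma form_0 [simp]: "b u 0 = 0" "b 0 u = 0"
  using form_scale(1)[of u 0 0] form_scale(2)[of 0 0 u] by (simp_all del: form_scale)

lemma form_sum: "b u (sum g A) = (\<Sum>x\<in>A. b u (g x))" "b (sum g A) u = (\<Sum>x\<in>A. b (g x) u)"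
  by (induction A rule: infinite_finite_induct) auto

lemma form_commute: "b u v = b v u"
  using bilinear_space by (auto simp: bilinear_space_def)

lemma form_nondegenerate: "(\<And>v. b u v = b w v) \<Longrightarrow> u = w"
  using bilinear_space unfolding bilinear_space_def eq_iff_add_eq_0[of u w] by auto

text \<open>A vector is determined by bit coefficients on a finite basis. Finiteness later permits
  the choice of a largest orthonormal set.\<close>

lemma finite_UNIV: "finite (UNIV :: 'v set)"
proof -
  obtain B where "finite_dimensional_vector_space s B" by (rule finite_dimensional)
  then interpret finite_dimensional_vector_space s B .
  have "UNIV \<subseteq> (\<lambda>u. \<Sum>v\<in>B. s (u v) v) ` (B \<rightarrow>\<^sub>E UNIV)"
  proof
    fix x :: 'v
    have "x \<in> range (\<lambda>u. \<Sum>v\<in>B. s (u v) v)"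
      using span_Basis span_finite[OF finite_Basis] by auto
    then obtain u where "x = (\<Sum>v\<in>B. s (u v) v)" by auto
    then have "x = (\<Sum>v\<in>B. s (restrict u B v) v)" by simp
    then show "x \<in> (\<lambda>u. \<Sum>v\<in>B. s (u v) v) ` (B \<rightarrow>\<^sub>E UNIV)"
      by (intro image_eqI[where x = "restrict u B"]) auto
  qed
  moreover have "finite (UNIV :: bit set)"
    by (rule finite_subset[of _ "{0, 1}"]) auto
  ultimately show ?thesis
    using finite_Basis by (meson finite_PiE finite_imageI finite_subset)
qed

section \<open>Orthonormal bases of non-symplectic spaces\<close>

definition orthonormal :: "'v set \<Rightarrow> bool" where
  "orthonormal E \<longleftrightarrow> (\<forall>x\<in>E. \<forall>y\<in>E. b x y = of_bool (x = y))"

lemma finite_set [simp]: "finite (E :: 'v set)"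
  by (rule finite_subset[OF subset_UNIV finite_UNIV])

lemma orthonormal_insert:
  assumes "orthonormal E" "b x x = 1" "\<And>e. e \<in> E \<Longrightarrow> b x e = 0"
  shows "orthonormal (insert x E)" "x \<notin> E"
proof -
  show x: "x \<notin> E" using assms(2,3) by auto
  have "b e x = 0" if "e \<in> E" for e
    using assms(3)[OF that] form_commute[of e x] by simp
  with x show "orthonormal (insert x E)"
    using assms unfolding orthonormal_def by (metis insert_iff of_bool_eq(1,2))
qed

text \<open>An orthonormal set \<open>E\<close> of maximal size works. By maximality the form is
  alternating on its orthogonal complement; a nonzero vector there would lie in a hyperbolic plane,
  and this plane together with one \<open>e\<close> in \<open>E\<close> would yield a larger
  orthonormal set.\<close>

lemma orthonormal_basis_exists:
  assumes "\<not> SYMP b"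
  obtains E where "orthonormal E" "\<And>v. v = (\<Sum>e\<in>E. s (b v e) e)"
proof -
  let ?C = "card ` {E. orthonormal E}"
  have "finite (Pow (UNIV :: 'v set))"
    by (simp only: finite_Pow_iff finite_UNIV)
  then have fin: "finite ?C"
    by (rule finite_imageI[OF finite_subset[rotated]]) auto
  have "orthonormal {}"
    by (simp add: orthonormal_def)
  then have "Max ?C \<in> ?C"
    by (intro Max_in fin) auto
  then obtain E where E: "orthonormal E" "card E = Max ?C"
    by auto
  have mx: "card F \<le> card E" if "orthonormal F" for F
    using Max_ge[OF fin, of "card F"] that E(2) by simp
  note E = E(1)
  define P where "P v = v + (\<Sum>e\<in>E. s (b v e) e)" for v
  have P_perp: "b (P v) e = 0" if "e \<in> E" for v e
  proof -
    have "(\<Sum>x\<in>E. b v x * b x e) = (\<Sum>x\<in>E. if x = e then b v x else 0)"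
      using E that by (intro sum.cong) (auto simp: orthonormal_def)
    then show ?thesis
      using that by (simp add: P_def form_sum)
  qed
  have alt: "b x x = 0" if "\<And>e. e \<in> E \<Longrightarrow> b x e = 0" for x
  proof (rule ccontr)
    assume "b x x \<noteq> 0"
    then have "orthonormal (insert x E)" "x \<notin> E"
      using orthonormal_insert[OF E, of x] that by auto
    then show False using mx[of "insert x E"] by simp
  qed
  \<comment> \<open>If \<open>E\<close> were empty, \<open>alt\<close> would apply to every vector
    and the form would be symplectic.\<close>
  obtain e where e: "e \<in> E"
    using assms alt unfolding SYMP_def by blast
  have orth_e: "orthonormal (E - {e})" "b e e = 1" "\<And>y. y \<in> E - {e} \<Longrightarrow> b e y = 0"
    using E e by (auto simp: orthonormal_def)
  have "P v = 0" for v
  proof (rule ccontr)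
    define x where "x = P v"
    assume "P v \<noteq> 0"
    then obtain w where w: "b x w = 1"
      using form_nondegenerate[of x 0] unfolding x_def by (metis bit_not_one_iff form_0(2))
    have x_perp: "b x y = 0" if "y \<in> E" for y
      using P_perp that by (simp add: x_def)
    \<comment> \<open>Projecting \<open>w\<close> keeps its product with \<open>x\<close>, since
      \<open>x\<close> is orthogonal to \<open>E\<close>; so \<open>x\<close> and \<open>y\<close>
      span a hyperbolic plane.\<close>
    define y where "y = P w"
    have y_perp: "b y z = 0" if "z \<in> E" for z
      using P_perp that by (simp add: y_def)
    have "b x y = 1"
      using w x_perp by (simp add: y_def P_def form_sum)
    then have xy: "b x x = 0" "b y y = 0" "b x y = 1" "b y x = 1"
      using alt x_perp y_perp form_commute[of x y] by auto
    have ex: "b x e = 0" "b y e = 0" "b e x = 0" "b e y = 0"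
      using x_perp y_perp e form_commute[of e x] form_commute[of e y] by auto
    text \<open>The plane spanned by \<open>x\<close> and \<open>y\<close> together with \<open>e\<close> has an orthonormal basis, so \<open>e\<close> can
      be exchanged for three vectors.\<close>
    define F1 where "F1 = insert (e + x) (E - {e})"
    define F2 where "F2 = insert (e + y) F1"
    define F3 where "F3 = insert (e + x + y) F2"
    have 1: "orthonormal F1" "e + x \<notin> E - {e}"
      unfolding F1_def
      by (rule orthonormal_insert; use orth_e xy ex x_perp in \<open>auto\<close>)+
    have 2: "orthonormal F2" "e + y \<notin> F1"
      unfolding F2_def
      by (rule orthonormal_insert[OF 1(1)]; use orth_e xy ex x_perp y_perp in \<open>auto simp: F1_def\<close>)+
    have 3: "orthonormal F3" "e + x + y \<notin> F2"
      unfolding F3_def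
      by (rule orthonormal_insert[OF 2(1)];
          use orth_e xy ex x_perp y_perp in \<open>auto simp: F1_def F2_def\<close>)+
    have "card F3 = card (E - {e}) + 3"
      using 1(2) 2(2) 3(2) by (simp add: F3_def F2_def F1_def)
    then show False
      using mx[OF 3(1)] e by (simp add: card_Diff_singleton)
  qed
  then have "v = (\<Sum>e\<in>E. s (b v e) e)" for v
    by (simp add: eq_iff_add_eq_0[of v] P_def)
  with E show ?thesis using that by blast
qed

section \<open>Linear functionals and the distinguished vector\<close>

lemma functional_represented:
  assumes "\<not> SYMP b" "Vector_Spaces.linear s (*) \<phi>"
  obtains w where "\<And>v. b w v = \<phi> v"
proof -
  obtain E where E: "\<And>v. v = (\<Sum>e\<in>E. s (b v e) e)"
    using orthonormal_basis_exists[OF assms(1)] by blast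
  interpret \<phi>: Vector_Spaces.linear s "(*)" \<phi> by fact
  \<comment> \<open>The coordinates of the representing vector are the values of
    \<open>\<phi>\<close> on the orthonormal basis.\<close>
  have "b (\<Sum>e\<in>E. s (\<phi> e) e) v = \<phi> v" for v
  proof -
    have "\<phi> v = \<phi> (\<Sum>e\<in>E. s (b v e) e)" by (simp flip: E)
    also have "\<dots> = (\<Sum>e\<in>E. b v e * \<phi> e)" by (simp add: \<phi>.sum \<phi>.scale)
    also have "\<dots> = b (\<Sum>e\<in>E. s (\<phi> e) e) v"
      by (simp only: form_sum form_scale form_commute[of v] mult.commute)
    finally show ?thesis by simp
  qed
  then show ?thesis using that by blast
qed

text \<open>Symmetry makes the two cross terms cancel in characteristic two, and every bit equals
  its own square.\<close>

lemma linear_form_square: "Vector_Spaces.linear s (*) (\<lambda>v. b v v)"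
proof -
  interpret Vector_Spaces.linear s "(*)" "b 0" by (rule form_linear)
  show ?thesis
  proof unfold_locales
    show "b (u + v) (u + v) = b u u + b v v" for u v
      by (cases "b u v"; cases "b u u"; cases "b v v") (simp_all add: form_commute[of v u])
    show "b (s c v) (s c v) = c * b v v" for c v
      by (cases c) auto
  qed
qed

lemma Omega_eqI:
  assumes "\<And>v. b w v = b v v"
  shows "Omega b = w"
  unfolding Omega_def using assms by (intro the_equality form_nondegenerate) auto

text \<open>Existence of the vector described by \<open>THE\<close>: squaring is a linear
  functional, hence represented by a vector. In the symplectic case this functional is zero and the
  vector is 0.\<close>

lemma form_Omega: "b (Omega b) v = b v v"
proof (cases "SYMP b")
  case True
  then show ?thesis using Omega_eqI[of 0] by (simp add: SYMP_def)
next
  case False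
  obtain w where "\<And>v. b w v = b v v"
    using functional_represented[OF False linear_form_square] by blast
  with Omega_eqI[of w] show ?thesis by simp
qed

lemma SYMP_iff_Omega: "SYMP b \<longleftrightarrow> Omega b = 0"
proof
  show "Omega b = 0" if "SYMP b"
    using that Omega_eqI[of 0] by (simp add: SYMP_def)
  show "SYMP b" if "Omega b = 0"
    using that form_Omega unfolding SYMP_def by (metis form_0(2))
qed

section \<open>Standard coordinates and the type of a space\<close>

lemma iso_standard_exists:
  assumes "\<not> SYMP b"
  obtains n where "n \<ge> 1" "iso_standard s b n"
proof -
  obtain E where E: "orthonormal E" and exp: "\<And>v. v = (\<Sum>e\<in>E. s (b v e) e)"
    using orthonormal_basis_exists[OF assms] by blast
  define n where "n = card E"
  obtain h where h: "bij_betw h {..<n} E"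
    using finite_set[of E] unfolding n_def atLeast0LessThan[symmetric]
    by (metis ex_bij_betw_nat_finite)
  then have hE: "h i \<in> E" "i < n \<Longrightarrow> j < n \<Longrightarrow> h i = h j \<longleftrightarrow> i = j" if "i < n" for i j
    using that by (auto simp: bij_betw_def inj_on_def)
  have expand: "v = (\<Sum>i<n. s (b v (h i)) (h i))" for v
    using exp[of v] sum.reindex_bij_betw[OF h, of "\<lambda>e. s (b v e) e"] by simp
  \<comment> \<open>Coordinates in the orthonormal basis, restricted to \<open>{..<n}\<close>
    because the target consists of extensional functions.\<close>
  define f where "f v = (\<lambda>i\<in>{..<n}. b v (h i))" for v
  have "bij_betw f UNIV ({..<n} \<rightarrow>\<^sub>E UNIV)"
  proof (rule bij_betwI)
    show "f \<in> UNIV \<rightarrow> {..<n} \<rightarrow>\<^sub>E UNIV" by (auto simp: f_def)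
    show "(\<lambda>a. \<Sum>i<n. s (a i) (h i)) \<in> ({..<n} \<rightarrow>\<^sub>E UNIV) \<rightarrow> UNIV" by simp
    show "(\<Sum>i<n. s (f v i) (h i)) = v" for v
      using expand[of v] by (simp add: f_def)
    show "f (\<Sum>i<n. s (a i) (h i)) = a" if "a \<in> {..<n} \<rightarrow>\<^sub>E UNIV" for a
    proof
      fix j
      show "f (\<Sum>i<n. s (a i) (h i)) j = a j"
      proof (cases "j < n")
        case True
        have "(\<Sum>i<n. a i * b (h i) (h j)) = (\<Sum>i<n. if i = j then a i else 0)"
          using E hE True by (intro sum.cong) (auto simp: orthonormal_def)
        with True show ?thesis by (simp add: f_def form_sum)
      next
        case False
        with that show ?thesis by (auto simp: f_def PiE_def extensional_def)
      qed
    qed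
  qed
  moreover have "Vector_Spaces.linear s (*) (\<lambda>v. f v i)" if "i < n" for i
    using that form_linear by (simp add: f_def)
  moreover have "b u v = (\<Sum>i<n. f u i * f v i)" for u v
  proof -
    have "b u v = b (\<Sum>i<n. s (b u (h i)) (h i)) v" by (simp flip: expand)
    also have "\<dots> = (\<Sum>i<n. f u i * f v i)"
      by (simp add: form_sum f_def form_commute[of v])
    finally show ?thesis .
  qed
  ultimately have "iso_standard s b n"
    unfolding iso_standard_def by blast
  \<comment> \<open>For \<open>n = 0\<close> every vector is zero, in particular
    \<open>Omega b\<close>, which would make the form symplectic.\<close>
  moreover have "n \<noteq> 0"
  proof
    assume "n = 0"
    then have "v = 0" for v :: 'v using expand[of v] by simp
    then show False using assms by (metis SYMP_iff_Omega)
  qed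
  ultimately show ?thesis using that by (metis less_one not_le)
qed

text \<open>In coordinates \<open>Omega b\<close> is the all-ones vector, because
  \<open>x * x = x\<close> for bits; its square is \<open>n\<close> modulo two.\<close>

lemma iso_standard_form_Omega:
  assumes "iso_standard s b n"
  shows "b (Omega b) (Omega b) = of_bool (odd n)"
proof -
  obtain f where f: "bij_betw f UNIV ({..<n} \<rightarrow>\<^sub>E (UNIV :: bit set))"
    and fb: "\<And>u v. b u v = (\<Sum>i<n. f u i * f v i)"
    using assms by (auto simp: iso_standard_def)
  have "(\<lambda>i\<in>{..<n}. 1) \<in> {..<n} \<rightarrow>\<^sub>E (UNIV :: bit set)" by auto
  then obtain w where w: "f w = (\<lambda>i\<in>{..<n}. 1)"
    using f by (metis bij_betw_imp_surj_on imageE)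
  have idem: "x * x = x" for x :: bit by (cases x) auto
  have "Omega b = w"
    by (rule Omega_eqI, unfold fb w idem, rule sum.cong) auto
  moreover have "of_nat n = (of_bool (odd n) :: bit)"
    by (induction n) auto
  ultimately show ?thesis by (simp add: fb w)
qed

text \<open>A non-symplectic space has some standard isomorphism, and the parity of \<open>n\<close>
  is the same for all of them, so the existential over \<open>n\<close> can be eliminated.\<close>

lemma EVO_iff: "EVO s b \<longleftrightarrow> \<not> SYMP b \<and> b (Omega b) (Omega b) = 0"
proof (cases "SYMP b")
  case False
  then obtain n where "n \<ge> 1" "iso_standard s b n" by (rule iso_standard_exists)
  with False show ?thesis
    by (auto simp: EVO_def dest: iso_standard_form_Omega intro!: exI[of _ n])
qed (simp add: EVO_def)

lemma ODDO_iff: "ODDO s b \<longleftrightarrow> b (Omega b) (Omega b) = 1"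
proof (cases "SYMP b")
  case False
  then obtain n where "n \<ge> 1" "iso_standard s b n" by (rule iso_standard_exists)
  with False show ?thesis
    by (auto simp: ODDO_def dest: iso_standard_form_Omega intro!: exI[of _ n])
qed (simp add: ODDO_def SYMP_def)

section \<open>Twisting by the distinguished vector\<close>

lemma twist_SYMP: "SYMP b \<Longrightarrow> twist s b f = f"
  by (auto simp: twist_def fun_eq_iff SYMP_iff_Omega)

lemma twist_twist: "twist s b (twist s b f) = f"
  by (simp add: twist_def fun_eq_iff add.assoc)

text \<open>The added term is the square of \<open>b v (Omega b)\<close>, and squaring is the
  identity on bits.\<close>

lemma form_twist: "b v (twist s b f v) = b v (f v) + b (Omega b) v"
  by (cases "b (Omega b) v") (simp_all add: twist_def form_commute[of v "Omega b"])

lemma alpha_not_ODDO: "\<not> ODDO s b \<Longrightarrow> alpha s b f = of_bool (\<exists>v. b v (f v) = 1)"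
  by (simp add: alpha_def)

lemma not_EVO_iff: "\<not> EVO s b \<longleftrightarrow> SYMP b \<or> ODDO s b"
  by (simp add: EVO_iff ODDO_iff)

lemma not_ODDO_of_SYMP: "SYMP b \<Longrightarrow> \<not> ODDO s b"
  by (simp add: ODDO_def)

lemma not_ODDO_of_EVO: "EVO s b \<Longrightarrow> \<not> ODDO s b"
  by (simp add: EVO_iff ODDO_iff)

lemma D_tilde_of_not_EVO: "\<not> EVO s b \<Longrightarrow> D_tilde s b f = D_inv s f"
  by (simp add: D_tilde_def)

text \<open>Twisting changes nothing on a symplectic space, so SYMP and EVO share one
  formula.\<close>

lemma D_tilde_of_not_ODDO: "\<not> ODDO s b \<Longrightarrow> D_tilde s b f = D_inv s (twist s b f)"
  using not_EVO_iff by (auto simp: D_tilde_def twist_SYMP)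

lemma alpha_tilde_of_not_EVO: "\<not> EVO s b \<Longrightarrow> alpha_tilde s b f = alpha s b f"
  by (simp add: alpha_tilde_def)

lemma linear_add_id:
  assumes "Vector_Spaces.linear s s f"
  shows "Vector_Spaces.linear s s (\<lambda>v. f v + v)"
proof -
  interpret Vector_Spaces.linear s s f by fact
  show ?thesis
    by unfold_locales (simp_all only: add scale scale_right_distrib ac_simps)
qed

lemma subspace_range_add_id:
  assumes "Vector_Spaces.linear s s f"
  shows "subspace (range (\<lambda>v. f v + v))"
  using module_hom.subspace_image[OF Vector_Spaces.linear.axioms(3)[OF linear_add_id[OF assms]]]
  by simp

lemma linear_twist:
  assumes "Vector_Spaces.linear s s f"
  shows "Vector_Spaces.linear s s (twist s b f)"
proof -
  interpret Vector_Spaces.linear s s f by fact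
  show ?thesis
    by unfold_locales
      (simp_all only: twist_def add scale form_add form_scale scale_right_distrib
        scale_left_distrib scale_scale ac_simps)
qed

text \<open>The range of the twist plus identity is the range of \<open>f + Id\<close> enlarged by
  the line through \<open>Omega b\<close>. The map is linear and self-adjoint rather than an
  involution, so that the rule can also be applied to a twisted map.\<close>

lemma D_twist_of_fixed:
  assumes lin: "Vector_Spaces.linear s s f" and adj: "\<And>u v. b (f u) v = b u (f v)"
    and y: "f y = y" "b (Omega b) y = 1"
  shows "D_inv s (twist s b f) = D_inv s f + 1"
proof -
  interpret f: Vector_Spaces.linear s s f by fact
  let ?R = "range (\<lambda>v. f v + v)" and ?N = "range (\<lambda>v. twist s b f v + v)"
  obtain B where "finite_dimensional_vector_space s B" by (rule finite_dimensional)
  then interpret finite_dimensional_vector_space s B .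
  have R: "span ?R = ?R"
    by (simp add: subspace_range_add_id[OF lin])
  have N: "subspace ?N"
    by (rule subspace_range_add_id[OF linear_twist[OF lin]])
  have N_eq: "twist s b f v + v = (f v + v) + s (b v (Omega b)) (Omega b)" for v
    by (simp only: twist_def ac_simps)
  have y': "b y (Omega b) = 1"
    using y(2) by (simp add: form_commute)
  have "Omega b \<notin> ?R"
  proof
    assume "Omega b \<in> ?R"
    then obtain z where "Omega b = f z + z" by blast
    \<comment> \<open>Self-adjointness moves \<open>f\<close> onto the fixed vector
      \<open>y\<close>, so the right-hand side is \<open>b y z + b y z\<close>, which is 0.\<close>
    then have "b y (Omega b) = b (f y) z + b y z"
      by (simp only: form_add adj)
    with y' y(1) show False by simp
  qed
  moreover have "span (insert (Omega b) ?R) = ?N"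
  proof
    \<comment> \<open>At \<open>y\<close> the part \<open>f y + y\<close> vanishes and the twist
      contributes exactly \<open>Omega b\<close>.\<close>
    have "Omega b = twist s b f y + y"
      using y' y(1) by (simp add: N_eq)
    then have Om: "Omega b \<in> ?N" by blast
    have "f v + v \<in> ?N" for v
    proof -
      have "f v + v = (twist s b f v + v) + s (b v (Omega b)) (Omega b)"
        by (simp add: N_eq add.assoc)
      moreover have "\<dots> \<in> ?N"
        by (rule subspace_add[OF N _ subspace_scale[OF N Om]]) blast
      ultimately show ?thesis by (simp only:)
    qed
    with Om show "span (insert (Omega b) ?R) \<subseteq> ?N"
      by (intro span_minimal[OF _ N]) blast
    show "?N \<subseteq> span (insert (Omega b) ?R)"
    proof
      fix x assume "x \<in> ?N"
      then obtain v where "x = (f v + v) + s (b v (Omega b)) (Omega b)"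
        by (auto simp: N_eq)
      then show "x \<in> span (insert (Omega b) ?R)"
        by (auto intro!: span_add[of "f v + v"] span_scale intro: span_base)
    qed
  qed
  ultimately have "dim ?N = dim (insert (Omega b) ?R)" "Omega b \<notin> span ?R"
    using dim_span[of "insert (Omega b) ?R"] by (simp_all only: R not_False_eq_True)
  then have "dim ?N = dim ?R + 1"
    by (simp only: dim_insert if_False)
  then show ?thesis
    by (simp add: D_inv_def)
qed

end

section \<open>Invariants of a single involution\<close>

locale F2_involution = F2_bilinear_space +
  fixes f :: "'a \<Rightarrow> 'a"
  assumes involution: "involution s b f"
begin

lemma linear: "Vector_Spaces.linear s s f"
  using involution by (simp add: involution_def isometry_def)

sublocale f: Vector_Spaces.linear s s f by (rule linear)

lemma f_f [simp]: "f (f v) = v"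
  using involution by (auto simp: involution_def fun_eq_iff)

lemma form_f_f [simp]: "b (f u) (f v) = b u v"
  using involution by (auto simp: involution_def isometry_def)

lemma form_f: "b (f u) v = b u (f v)"
  using form_f_f[of u "f v"] by simp

text \<open>\<open>b (f (Omega b)) v = b (f v) (f v) = b v v\<close>, and this property
  characterizes \<open>Omega b\<close>.\<close>

lemma f_Omega [simp]: "f (Omega b) = Omega b"
proof -
  have "b (f (Omega b)) v = b v v" for v
    by (simp add: form_f form_Omega)
  then show ?thesis by (metis Omega_eqI)
qed

text \<open>The cross terms \<open>b u (f v)\<close> and \<open>b v (f u)\<close> agree by
  self-adjointness and symmetry, so they cancel.\<close>

lemma form_f_add: "b (u + v) (f (u + v)) = b u (f u) + b v (f v)"
proof -
  have "b v (f u) = b u (f v)"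
    by (metis form_f form_commute)
  then show ?thesis
    by (cases "b u (f v)"; cases "b u (f u)"; cases "b v (f v)") (simp_all add: f.add)
qed

text \<open>One formula for all three types. Outside ODDO it comes from \<open>form_twist\<close>.
  For ODDO the functional vanishes at \<open>Omega b\<close>, so a witness can be moved into the
  complement of \<open>Omega b\<close>.\<close>

lemma alpha_tilde_eq: "alpha_tilde s b f = of_bool (\<exists>v. b v (f v) + b (Omega b) v = 1)"
proof (cases "ODDO s b")
  case True
  then have O: "b (Omega b) (Omega b) = 1"
    by (simp only: ODDO_iff)
  have "\<exists>v. b (Omega b) v = 0 \<and> b v (f v) = 1" if "b v (f v) + b (Omega b) v = 1" for v
  proof (cases "b (Omega b) v")
    assume "b (Omega b) v = 0"
    with that show ?thesis by (intro exI[of _ v]) simp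
  next
    assume "b (Omega b) v = 1"
    \<comment> \<open>Here \<open>b v (f v) = 0\<close>. Adding \<open>Omega b\<close> to
      \<open>v\<close> changes the pair of \<open>b (Omega b) v\<close> and \<open>b v (f v)\<close>
      from 1, 0 to 0, 1.\<close>
    with that O show ?thesis
      by (intro exI[of _ "v + Omega b"]) (simp only: form_f_add form_add(1), simp)
  qed
  moreover have "b v (f v) + b (Omega b) v = 1" if "b (Omega b) v = 0 \<and> b v (f v) = 1" for v
    using that by simp
  ultimately have "(\<exists>v. b (Omega b) v = 0 \<and> b v (f v) = 1) \<longleftrightarrow>
      (\<exists>v. b v (f v) + b (Omega b) v = 1)"
    by blast
  moreover have "\<not> EVO s b"
    using True not_ODDO_of_EVO by blast
  ultimately show ?thesis
    using True by (simp only: alpha_tilde_of_not_EVO alpha_def if_True not_False_eq_True)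
next
  case False
  then have "alpha_tilde s b f = alpha s b (twist s b f)"
    using not_EVO_iff by (auto simp: alpha_tilde_def twist_SYMP)
  also have "\<dots> = of_bool (\<exists>v. b v (f v) + b (Omega b) v = 1)"
    using alpha_not_ODDO[OF False, of "twist s b f"] by (simp only: form_twist)
  finally show ?thesis .
qed

lemma D_twist_eq_plus_1:
  "f y = y \<Longrightarrow> b (Omega b) y = 1 \<Longrightarrow> D_inv s (twist s b f) = D_inv s f + 1"
  by (rule D_twist_of_fixed[OF linear form_f])

text \<open>The increase by one read backwards: \<open>y\<close> is fixed by the twist of
  \<open>f\<close>, and twisting again returns \<open>f\<close>.\<close>

lemma D_twist_eq_minus_1:
  assumes "f y + y = Omega b" "b (Omega b) y = 1"
  shows "D_inv s (twist s b f) = D_inv s f - 1"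
proof -
  have adj: "b (twist s b f u) v = b u (twist s b f v)" for u v
    by (simp only: twist_def form_add form_scale form_f form_commute[of v "Omega b"] mult.commute)
  have "f y + (y + Omega b) = 0"
    using assms(1) by (simp flip: add.assoc)
  then have "twist s b f y = y"
    using assms(2) unfolding eq_iff_add_eq_0[of "twist s b f y"]
    by (simp add: twist_def form_commute[of y "Omega b"] ac_simps)
  then show ?thesis
    using D_twist_of_fixed[OF linear_twist[OF linear] adj _ assms(2)] by (simp add: twist_twist)
qed

text \<open>The twist plus identity is \<open>f + Id\<close> precomposed with \<open>h\<close>,
  which adds \<open>b v (Omega b)\<close> times \<open>y\<close> to \<open>v\<close>. As
  \<open>b y (Omega b) = 0\<close>, \<open>h\<close> is its own inverse and the ranges
  agree.\<close>

lemma D_twist_eq: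
  assumes y: "f y + y = Omega b" "b (Omega b) y = 0"
  shows "D_inv s (twist s b f) = D_inv s f"
proof -
  have y': "b y (Omega b) = 0"
    using y(2) by (simp add: form_commute)
  define h where "h v = v + s (b v (Omega b)) y" for v
  have eq: "twist s b f v + v = f (h v) + h v" for v
  proof -
    show ?thesis
      by (simp only: twist_def h_def f.add f.scale scale_right_distrib ac_simps flip: y(1))
  qed
  have "h (h v) = v" for v
    by (simp add: h_def y' add.assoc)
  then have "surj h" by (metis surjI)
  then have "range (\<lambda>v. twist s b f v + v) = range (\<lambda>v. f v + v)"
    unfolding eq using image_image[of "\<lambda>v. f v + v" h UNIV] by simp
  then show ?thesis by (simp add: D_inv_def)
qed

text \<open>The image of \<open>f + Id\<close> is the orthogonal complement of its kernel.\<close>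

lemma fixed_vector_of_not_in_range:
  assumes "\<not> SYMP b" "\<And>y. f y + y \<noteq> x"
  obtains w where "f w = w" "b w x = 1"
proof -
  let ?R = "range (\<lambda>v. f v + v)"
  obtain B where B: "B \<subseteq> ?R" "independent B" "?R \<subseteq> span B"
    using maximal_independent_subset by blast
  have "x \<notin> span B"
    using assms(2) span_minimal[OF B(1) subspace_range_add_id[OF linear]] by blast
  then have ind: "independent (insert x B)"
    using B(2) by (rule independent_insertI)
  interpret form: Vector_Spaces.linear s "(*)" "b 0" by (rule form_linear)
  interpret pair: vector_space_pair s "(*) :: bit \<Rightarrow> bit \<Rightarrow> bit" ..
  \<comment> \<open>This functional vanishes on \<open>B\<close>, hence on the range of
    \<open>f + Id\<close>, and is 1 at \<open>x\<close>.\<close>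
  obtain \<phi> where \<phi>: "Vector_Spaces.linear s (*) \<phi>" "\<And>v. v \<in> insert x B \<Longrightarrow> \<phi> v = of_bool (v = x)"
    using pair.linear_independent_extend[OF ind, of "\<lambda>v. of_bool (v = x)"] by blast
  obtain w where w: "\<And>v. b w v = \<phi> v"
    using functional_represented[OF assms(1) \<phi>(1)] by blast
  interpret \<phi>: Vector_Spaces.linear s "(*)" \<phi> by (rule \<phi>(1))
  have "\<phi> v = 0" if "v \<in> B" for v
    using \<phi>(2)[of v] that \<open>x \<notin> span B\<close> by (auto intro: span_base)
  then have "\<phi> v = 0" if "v \<in> span B" for v
    using \<phi>.eq_0_on_span that by blast
  then have "b w (f v + v) = 0" for v
    using B(3) by (auto simp only: w)
  \<comment> \<open>Moving \<open>f\<close> to the left argument shows that \<open>f w\<close> and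
    \<open>w\<close> pair equally with every vector.\<close>
  then have "b (f w) v = b w v" for v
    unfolding bit_eq_iff_add[of "b (f w) v"] by (simp only: form_f form_add)
  then have "f w = w" by (rule form_nondegenerate)
  then show ?thesis using that w \<phi>(2)[of x] by simp
qed

text \<open>If \<open>Omega b\<close> is not in the range of \<open>f + Id\<close>, duality between
  range and kernel gives the first case; otherwise the bit \<open>b (Omega b) y\<close> of a
  preimage \<open>y\<close> decides.\<close>

lemma D_twist_cases:
  assumes "\<not> SYMP b"
  obtains
    (plus_1) y where "f y = y" "b (Omega b) y = 1"
  | (eq) y where "f y + y = Omega b" "b (Omega b) y = 0"
  | (minus_1) y where "f y + y = Omega b" "b (Omega b) y = 1"
proof (cases "\<exists>y. f y + y = Omega b")
  case True
  then obtain y where "f y + y = Omega b" by blast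
  then show ?thesis using that(2,3) by (cases "b (Omega b) y") simp_all
next
  case False
  then obtain w where "f w = w" "b w (Omega b) = 1"
    using fixed_vector_of_not_in_range[OF assms, of "Omega b"] by blast
  then show ?thesis
    using that(1)[of w] form_commute[of w "Omega b"] by simp
qed

end

section \<open>Orthogonal sums of bilinear spaces\<close>

locale F2_bilinear_space_pair = B: F2_bilinear_space s b + C: F2_bilinear_space t c
  for s b t c
begin

sublocale S: F2_bilinear_space "module_prod.scale s t" "sum_form b c"
  using bilinear_space_sum[OF B.bilinear_space C.bilinear_space] by unfold_locales

lemma Omega_sum: "Omega (sum_form b c) = (Omega b, Omega c)"
  by (rule S.Omega_eqI) (simp add: sum_form_def B.form_Omega C.form_Omega)

lemma sum_form_Omega:
  "sum_form b c (Omega (sum_form b c)) x = b (Omega b) (fst x) + c (Omega c) (snd x)"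
  by (simp only: Omega_sum sum_form_def fst_conv snd_conv)

text \<open>The square of the distinguished vector adds over the sum, and it is 1 exactly for
  ODDO.\<close>

lemma ODDO_sum_iff:
  "ODDO (module_prod.scale s t) (sum_form b c) \<longleftrightarrow> ODDO s b \<noteq> ODDO t c"
  by (simp only: S.ODDO_iff B.ODDO_iff C.ODDO_iff sum_form_Omega)
    (simp only: Omega_sum fst_conv snd_conv bit_add_eq_1_iff)

text \<open>The range for the sum is the product of the two ranges. Arbitrary linear maps are
  allowed, so twists are covered too.\<close>

lemma D_inv_sum:
  assumes f: "Vector_Spaces.linear s s f" and g: "Vector_Spaces.linear t t g"
  shows "D_inv (module_prod.scale s t) (map_prod f g) = D_inv s f + D_inv t g"
proof -
  obtain E where "finite_dimensional_vector_space s E" by (rule B.finite_dimensional)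
  moreover obtain F where "finite_dimensional_vector_space t F" by (rule C.finite_dimensional)
  ultimately interpret P: finite_dimensional_vector_space_prod s t E F
    by (simp add: finite_dimensional_vector_space_prod_def finite_dimensional_vector_space_pair_def
        vector_space_prod_def vector_space_pair_def finite_dimensional_vector_space_def)
  have "range (\<lambda>v. map_prod f g v + v) = range (\<lambda>v. f v + v) \<times> range (\<lambda>v. g v + v)"
    by (auto simp: image_iff)
  then show ?thesis
    by (simp add: D_inv_def
        P.dim_Times[OF B.subspace_range_add_id[OF f] C.subspace_range_add_id[OF g]])
qed

lemma module_prod_scale: "module_prod.scale s t a x = (s a (fst x), t a (snd x))"
proof -
  interpret module_prod s t ..
  show ?thesis by (rule scale_def)
qed

lemma sum_form_map_prod:
  "sum_form b c x (map_prod f g x) = b (fst x) (f (fst x)) + c (snd x) (g (snd x))"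
  by (simp only: sum_form_def fst_map_prod snd_map_prod)

text \<open>Vanishing at 0 lets a witness in one summand be padded with the zero vector.\<close>

lemma ex_sum_eq_1_iff:
  assumes "P 0 = 0" "Q 0 = 0"
  shows "(\<exists>x. P (fst x) + Q (snd x) = (1::bit)) \<longleftrightarrow>
    (\<exists>u::'a. P u = 1) \<or> (\<exists>w::'b. Q w = 1)"
proof
  show "(\<exists>u. P u = 1) \<or> (\<exists>w. Q w = 1)" if "\<exists>x. P (fst x) + Q (snd x) = 1"
    using that by (auto simp: bit_add_eq_1_iff)
  show "\<exists>x. P (fst x) + Q (snd x) = 1" if "(\<exists>u. P u = 1) \<or> (\<exists>w. Q w = 1)"
    using that assms by (metis add.left_neutral add.right_neutral fst_conv snd_conv)
qed

text \<open>The sum is again not ODDO, so the same clause of \<open>alpha\<close> applies to all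
  three spaces.\<close>

lemma alpha_sum_of_not_ODDO:
  assumes "\<not> ODDO s b" "\<not> ODDO t c"
  shows "alpha (module_prod.scale s t) (sum_form b c) (map_prod f g) = max (alpha s b f) (alpha t c g)"
proof -
  have "\<not> ODDO (module_prod.scale s t) (sum_form b c)"
    using assms by (simp only: ODDO_sum_iff)
  then show ?thesis
    using ex_sum_eq_1_iff[of "\<lambda>v. b v (f v)" "\<lambda>v. c v (g v)"]
    by (simp only: S.alpha_not_ODDO B.alpha_not_ODDO[OF assms(1)] C.alpha_not_ODDO[OF assms(2)]
        not_False_eq_True sum_form_map_prod max_of_bool B.form_0 C.form_0)
qed

end

section \<open>Sums of involutions, by type of the summands\<close>

locale F2_involution_pair = B: F2_involution s b f + C: F2_involution t c g
  for s b f t c g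
begin

sublocale F2_bilinear_space_pair s b t c ..

sublocale S: F2_involution "module_prod.scale s t" "sum_form b c" "map_prod f g"
  using involution_sum[OF B.involution C.involution] by unfold_locales

abbreviation "scale_sum \<equiv> module_prod.scale s t"
abbreviation "form_sum \<equiv> sum_form b c"
abbreviation "inv_sum \<equiv> map_prod f g"

lemma D_sum: "D_inv scale_sum inv_sum = D_inv s f + D_inv t g"
  by (rule D_inv_sum[OF B.linear C.linear])

text \<open>The functional in \<open>alpha_tilde_eq\<close> has the same form for every type and
  splits over the summands, so no case distinction on types arises.\<close>

lemma alpha_tilde_sum: "alpha_tilde scale_sum form_sum inv_sum = max (alpha_tilde s b f) (alpha_tilde t c g)"
proof -
  have "sum_form b c x (map_prod f g x) + sum_form b c (Omega (sum_form b c)) x =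
    (b (fst x) (f (fst x)) + b (Omega b) (fst x)) + (c (snd x) (g (snd x)) + c (Omega c) (snd x))" for x
    by (simp only: sum_form_map_prod sum_form_Omega ac_simps)
  then show ?thesis
    using ex_sum_eq_1_iff[of "\<lambda>v. b v (f v) + b (Omega b) v" "\<lambda>v. c v (g v) + c (Omega c) v"]
    by (simp only: S.alpha_tilde_eq B.alpha_tilde_eq C.alpha_tilde_eq max_of_bool B.form_0 C.form_0
        add_0_left)
qed

text \<open>The sum is ODDO, where \<open>alpha\<close> and \<open>alpha_tilde\<close>
  coincide.\<close>

lemma alpha_sum_of_ODDO:
  assumes "ODDO s b \<noteq> ODDO t c"
  shows "alpha scale_sum form_sum inv_sum = max (alpha_tilde s b f) (alpha_tilde t c g)"
proof -
  have "\<not> EVO scale_sum form_sum"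
    using assms S.not_EVO_iff ODDO_sum_iff by blast
  then show ?thesis
    using S.alpha_tilde_of_not_EVO[of inv_sum] alpha_tilde_sum by simp
qed

text \<open>If one summand is ODDO, so is the sum, and no twist enters. Otherwise none of the three
  spaces is ODDO and \<open>D_tilde\<close> is the rank for the twist on each.\<close>

lemma DD_sum_of_SYMP:
  assumes "SYMP b \<or> SYMP c"
  shows "DD scale_sum form_sum inv_sum = DD s b f \<sharp> DD t c g"
proof (cases "ODDO s b \<or> ODDO t c")
  case True
  then have "ODDO s b \<noteq> ODDO t c" and "\<not> EVO s b" "\<not> EVO t c"
    using assms B.not_ODDO_of_SYMP C.not_ODDO_of_SYMP B.not_EVO_iff C.not_EVO_iff by blast+
  moreover from this(1) have "\<not> EVO scale_sum form_sum"
    using S.not_EVO_iff ODDO_sum_iff by blast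
  ultimately show ?thesis
    by (simp add: DD_def D_sum alpha_tilde_sum alpha_sum_of_ODDO S.D_tilde_of_not_EVO
        B.D_tilde_of_not_EVO C.D_tilde_of_not_EVO B.alpha_tilde_of_not_EVO C.alpha_tilde_of_not_EVO)
next
  case False
  then have not_ODDO: "\<not> ODDO s b" "\<not> ODDO t c" by auto
  then have S: "\<not> ODDO scale_sum form_sum"
    using ODDO_sum_iff by blast
  \<comment> \<open>One of \<open>Omega b\<close> and \<open>Omega c\<close> is 0, so the mixed
    terms of the twist of the sum vanish.\<close>
  have "twist scale_sum form_sum inv_sum = map_prod (twist s b f) (twist t c g)"
    using assms
    by (auto simp: twist_def fun_eq_iff Omega_sum sum_form_def module_prod_scale
        B.SYMP_iff_Omega C.SYMP_iff_Omega)
  then have "D_tilde scale_sum form_sum inv_sum = D_tilde s b f + D_tilde t c g"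
    using D_inv_sum[OF B.linear_twist[OF B.linear] C.linear_twist[OF C.linear]] not_ODDO S
    by (simp add: S.D_tilde_of_not_ODDO B.D_tilde_of_not_ODDO C.D_tilde_of_not_ODDO)
  then show ?thesis
    using not_ODDO by (simp add: DD_def D_sum alpha_tilde_sum alpha_sum_of_not_ODDO)
qed

text \<open>The vector \<open>(Omega b, 0)\<close> is fixed and has square 1. It therefore witnesses
  both the increase of the rank and the value 1 of \<open>alpha\<close>.\<close>

lemma DD_sum_of_ODDO_ODDO:
  assumes "ODDO s b" "ODDO t c"
  shows "DD scale_sum form_sum inv_sum =
    (D_inv s f + D_inv t g, 1, D_inv s f + D_inv t g + 1, max (alpha s b f) (alpha t c g))"
proof -
  have O: "b (Omega b) (Omega b) = 1"
    using assms(1) by (simp only: B.ODDO_iff)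
  have S: "\<not> ODDO scale_sum form_sum"
    using assms ODDO_sum_iff by blast
  have "D_inv scale_sum (twist scale_sum form_sum inv_sum) = D_inv scale_sum inv_sum + 1"
    by (rule S.D_twist_eq_plus_1[of "(Omega b, 0)"]) (simp_all add: sum_form_Omega O C.f.zero)
  moreover have "form_sum (Omega b, 0) (inv_sum (Omega b, 0)) = 1"
    by (simp add: sum_form_def O C.f.zero)
  then have "alpha scale_sum form_sum inv_sum = 1"
    unfolding S.alpha_not_ODDO[OF S] of_bool_eq_1_iff by (rule exI)
  moreover have "\<not> EVO s b" "\<not> EVO t c"
    using assms B.not_ODDO_of_EVO C.not_ODDO_of_EVO by blast+
  ultimately show ?thesis
    by (simp add: DD_def D_sum alpha_tilde_sum S.D_tilde_of_not_ODDO[OF S]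
        B.alpha_tilde_of_not_EVO C.alpha_tilde_of_not_EVO)
qed

text \<open>The sum is ODDO, so its third and fourth entries repeat the first two; on the ODDO
  summand \<open>alpha_tilde\<close> is \<open>alpha\<close>.\<close>

lemma DD_sum_of_ODDO_EVO:
  assumes "ODDO s b" "EVO t c"
  shows "DD scale_sum form_sum inv_sum =
    (D_inv s f + D_inv t g, max (alpha s b f) (alpha_tilde t c g),
     D_inv s f + D_inv t g, max (alpha s b f) (alpha_tilde t c g))"
proof -
  have "ODDO s b \<noteq> ODDO t c" "\<not> EVO s b"
    using assms B.not_ODDO_of_EVO C.not_ODDO_of_EVO by blast+
  moreover from this(1) have "\<not> EVO scale_sum form_sum"
    using S.not_EVO_iff ODDO_sum_iff by blast
  ultimately show ?thesis
    by (simp add: DD_def D_sum alpha_tilde_sum alpha_sum_of_ODDO S.D_tilde_of_not_EVO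
        B.alpha_tilde_of_not_EVO)
qed

text \<open>The correction is the rank change for the sum minus the two separate changes. A fixed
  witness in either summand gives +1 for the sum; otherwise the preimages \<open>y\<close> and
  \<open>z\<close> combine to \<open>(y, z)\<close> and their bits add.\<close>

lemma D_tilde_sum_of_EVO_EVO:
  assumes "EVO s b" "EVO t c"
  defines "DB \<equiv> D_inv s f" and "DC \<equiv> D_inv t g"
    and "TB \<equiv> D_tilde s b f" and "TC \<equiv> D_tilde t c g"
  shows "D_tilde scale_sum form_sum inv_sum = TB + TC +
    (if TB = DB \<or> TC = DC then 0 else if TB > DB \<and> TC > DC then - 1
     else if TB > DB \<and> TC < DC then 1 else if TB < DB \<and> TC > DC then 1 else 2)"
proof -
  let ?T = "D_inv scale_sum (twist scale_sum form_sum inv_sum)"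
  have EB: "\<not> SYMP b" "TB = D_inv s (twist s b f)" and EC: "\<not> SYMP c" "TC = D_inv t (twist t c g)"
    using assms(1,2) by (simp_all add: EVO_def TB_def TC_def D_tilde_def)
  have S: "\<not> ODDO scale_sum form_sum"
    using assms(1,2) ODDO_sum_iff B.not_ODDO_of_EVO C.not_ODDO_of_EVO by blast
  have T: "D_tilde scale_sum form_sum inv_sum = ?T"
    by (rule S.D_tilde_of_not_ODDO[OF S])
  have D: "D_inv scale_sum inv_sum = DB + DC"
    by (simp only: D_sum DB_def DC_def)
  note [simp] = EB(2) EC(2) T D DB_def[symmetric] DC_def[symmetric] sum_form_def Omega_sum
    B.f.zero C.f.zero
  show ?thesis
  proof (rule B.D_twist_cases[OF EB(1)])
    fix y assume y: "f y = y" "b (Omega b) y = 1"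
    \<comment> \<open>The witness \<open>(y, 0)\<close> serves whichever case holds for
      \<open>g\<close>, so those three cases are treated together.\<close>
    have "?T = D_inv scale_sum inv_sum + 1"
      by (rule S.D_twist_eq_plus_1[of "(y, 0)"]) (simp_all add: y)
    with B.D_twist_eq_plus_1[OF y] show ?thesis
      by (rule_tac C.D_twist_cases[OF EC(1)])
        (auto dest: C.D_twist_eq_plus_1 C.D_twist_eq C.D_twist_eq_minus_1)
  next
    fix y assume y: "f y + y = Omega b" "b (Omega b) y = 0"
    note B = B.D_twist_eq[OF y]
    show ?thesis
    proof (rule C.D_twist_cases[OF EC(1)])
      fix z assume z: "g z = z" "c (Omega c) z = 1"
      have "?T = D_inv scale_sum inv_sum + 1"
        by (rule S.D_twist_eq_plus_1[of "(0, z)"]) (simp_all add: z)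
      with B C.D_twist_eq_plus_1[OF z] show ?thesis by simp
    next
      fix z assume z: "g z + z = Omega c" "c (Omega c) z = 0"
      have "?T = D_inv scale_sum inv_sum"
        by (rule S.D_twist_eq[of "(y, z)"]) (simp_all add: y z)
      with B C.D_twist_eq[OF z] show ?thesis by simp
    next
      fix z assume z: "g z + z = Omega c" "c (Omega c) z = 1"
      have "?T = D_inv scale_sum inv_sum - 1"
        by (rule S.D_twist_eq_minus_1[of "(y, z)"]) (simp_all add: y z)
      with B C.D_twist_eq_minus_1[OF z] show ?thesis by simp
    qed
  next
    fix y assume y: "f y + y = Omega b" "b (Omega b) y = 1"
    note B = B.D_twist_eq_minus_1[OF y]
    show ?thesis
    proof (rule C.D_twist_cases[OF EC(1)])
      fix z assume z: "g z = z" "c (Omega c) z = 1"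
      have "?T = D_inv scale_sum inv_sum + 1"
        by (rule S.D_twist_eq_plus_1[of "(0, z)"]) (simp_all add: z)
      with B C.D_twist_eq_plus_1[OF z] show ?thesis by simp
    next
      fix z assume z: "g z + z = Omega c" "c (Omega c) z = 0"
      have "?T = D_inv scale_sum inv_sum - 1"
        by (rule S.D_twist_eq_minus_1[of "(y, z)"]) (simp_all add: y z)
      with B C.D_twist_eq[OF z] show ?thesis by simp
    next
      fix z assume z: "g z + z = Omega c" "c (Omega c) z = 1"
      \<comment> \<open>The two bits equal to 1 cancel: the rank for the sum is unchanged while each
        summand loses one, whence the correction 2.\<close>
      have "?T = D_inv scale_sum inv_sum"
        by (rule S.D_twist_eq[of "(y, z)"]) (simp_all add: y z)
      with B C.D_twist_eq_minus_1[OF z] show ?thesis by simp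
    qed
  qed
qed

text \<open>Isolates the third entry as the only one needing a correction, left as a difference for
  \<open>D_tilde_sum_of_EVO_EVO\<close> to evaluate.\<close>

lemma DD_sum_of_EVO_EVO:
  assumes "EVO s b" "EVO t c"
  shows "DD scale_sum form_sum inv_sum = (DD s b f \<sharp> DD t c g) +
    (0, 0, D_tilde scale_sum form_sum inv_sum - (D_tilde s b f + D_tilde t c g), 0)"
  using assms B.not_ODDO_of_EVO C.not_ODDO_of_EVO
  by (simp add: DD_def D_sum alpha_sum_of_not_ODDO alpha_tilde_sum)

end

theorem theorem5p4:
  fixes sU :: "bit \<Rightarrow> 'u::ab_group_add \<Rightarrow> 'u" and bU :: "'u \<Rightarrow> 'u \<Rightarrow> bit"
    and sW :: "bit \<Rightarrow> 'w::ab_group_add \<Rightarrow> 'w" and bW :: "'w \<Rightarrow> 'w \<Rightarrow> bit"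
    and \<sigma> :: "'u \<Rightarrow> 'u" and \<theta> :: "'w \<Rightarrow> 'w"
  assumes "bilinear_space sU bU" and "bilinear_space sW bW"
    and "involution sU bU \<sigma>" and "involution sW bW \<theta>"
  shows "let DDsum = DD (module_prod.scale sU sW) (sum_form bU bW) (map_prod \<sigma> \<theta>) in
      (SYMP bU \<or> SYMP bW \<longrightarrow> DDsum = DD sU bU \<sigma> \<sharp> DD sW bW \<theta>)
    \<and> (ODDO sU bU \<and> ODDO sW bW \<longrightarrow>
        DDsum = (D_inv sU \<sigma> + D_inv sW \<theta>, 1, D_inv sU \<sigma> + D_inv sW \<theta> + 1,
                 max (alpha sU bU \<sigma>) (alpha sW bW \<theta>)) \<and>
        DDsum = (DD sU bU \<sigma> \<sharp> DD sW bW \<theta>) \<sharp> (0, 1, 1, 0))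
    \<and> (ODDO sU bU \<and> EVO sW bW \<longrightarrow>
        DDsum = (D_inv sU \<sigma> + D_inv sW \<theta>,
                 max (alpha sU bU \<sigma>) (alpha_tilde sW bW \<theta>),
                 D_inv sU \<sigma> + D_inv sW \<theta>,
                 max (alpha sU bU \<sigma>) (alpha_tilde sW bW \<theta>)))
    \<and> (EVO sU bU \<and> EVO sW bW \<longrightarrow>
        DDsum = (DD sU bU \<sigma> \<sharp> DD sW bW \<theta>) +
          (if D_tilde sU bU \<sigma> = D_inv sU \<sigma> \<or> D_tilde sW bW \<theta> = D_inv sW \<theta> then (0, 0, 0, 0)
           else if D_tilde sU bU \<sigma> > D_inv sU \<sigma> \<and> D_tilde sW bW \<theta> > D_inv sW \<theta> then (0, 0, -1, 0)
           else if D_tilde sU bU \<sigma> > D_inv sU \<sigma> \<and> D_tilde sW bW \<theta> < D_inv sW \<theta> then (0, 0, 1, 0)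
           else if D_tilde sU bU \<sigma> < D_inv sU \<sigma> \<and> D_tilde sW bW \<theta> > D_inv sW \<theta> then (0, 0, 1, 0)
           else (0, 0, 2, 0)))"
proof -
  interpret U: F2_involution sU bU \<sigma>
    using assms(1,3) by unfold_locales
  interpret W: F2_involution sW bW \<theta>
    using assms(2,4) by unfold_locales
  interpret F2_involution_pair sU bU \<sigma> sW bW \<theta> ..
  have b: "DD scale_sum form_sum inv_sum = (DD sU bU \<sigma> \<sharp> DD sW bW \<theta>) \<sharp> (0, 1, 1, 0)"
    if "ODDO sU bU" "ODDO sW bW"
  proof -
    \<comment> \<open>These bounds make the maximum with 1 equal to 1 and the maximum with 0
      harmless.\<close>
    have le: "0 \<le> alpha sU bU \<sigma>" "alpha sU bU \<sigma> \<le> 1" "0 \<le> alpha sW bW \<theta>" "alpha sW bW \<theta> \<le> 1"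
      by (simp_all add: alpha_def)
    have "\<not> EVO sU bU" "\<not> EVO sW bW"
      using that U.not_ODDO_of_EVO W.not_ODDO_of_EVO by blast+
    then show ?thesis
      unfolding DD_sum_of_ODDO_ODDO[OF that] using le
      by (simp add: DD_def U.D_tilde_of_not_EVO W.D_tilde_of_not_EVO
          U.alpha_tilde_of_not_EVO W.alpha_tilde_of_not_EVO)
  qed
  show ?thesis
    unfolding Let_def
    by (intro conjI impI; (elim conjE)?)
      (simp_all add: DD_sum_of_SYMP DD_sum_of_ODDO_EVO b DD_sum_of_ODDO_ODDO[symmetric]
        DD_sum_of_EVO_EVO D_tilde_sum_of_EVO_EVO)
qed

end
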